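(* Every connected graph $G$ has a tree-cut decomposition $(T,\mathcal X)$, $\mathcal X=\{X_t: t\in V(T)\}$, of finite adhesion whose parts are exactly the $\omega$-edge blocks of $G$, and such that for every edge $t_1t_2\in E(T)$ there exists an edge of $G$ between $X_{t_1}$ and $X_{t_2}$.
   Context: Two vertices $x,y$ of $G$ are finitely separable if some finite set of edges separates them in $G$. Writing $x\sim y$ if $x,y$ are not finitely separable gives an equivalence relation on $V(G)$ whose classes are the $\omega$-edge blocks of $G$. A tree-cut decomposition of $G$ is a pair $(T,\mathcal X)$ where $T$ is a tree and $\mathcal X=\{X_t:t\in V(T)\}$ is a partition of $V(G)$ into nonempty sets (parts) indexed by the nodes of $T$. For an edge $e=t_1t_2$ of $T$ with $T_1\ni t_1$, $T_2\ni t_2$ the components of $T-e$, its adhesion set is $X_e=E_G(\bigcup_{t\in T_1}X_t,\bigcup_{t\in T_2}X_t)$. The decomposition has finite adhesion if all adhesion sets are finite. *)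

theory Defs
  imports Main
begin

definition graph :: "'a set \<Rightarrow> 'a set set \<Rightarrow> bool" where
  "graph V E \<longleftrightarrow> (\<forall>e\<in>E. \<exists>u v. u \<noteq> v \<and> u \<in> V \<and> v \<in> V \<and> e = {u, v})"

definition reach :: "'a set \<Rightarrow> 'a set set \<Rightarrow> 'a \<Rightarrow> 'a \<Rightarrow> bool" where
  "reach V F x y \<longleftrightarrow> x \<in> V \<and> (\<lambda>u v. u \<in> V \<and> v \<in> V \<and> {u, v} \<in> F)\<^sup>*\<^sup>* x y"

definition connected_graph :: "'a set \<Rightarrow> 'a set set \<Rightarrow> bool" where
  "connected_graph V E \<longleftrightarrow> graph V E \<and> V \<noteq> {} \<and> (\<forall>x\<in>V. \<forall>y\<in>V. reach V E x y)"

definition has_cycle :: "'a set \<Rightarrow> 'a set set \<Rightarrow> bool" where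
  "has_cycle V E \<longleftrightarrow> (\<exists>cs. length cs \<ge> 3 \<and> distinct cs \<and> set cs \<subseteq> V \<and>
      (\<forall>i. Suc i < length cs \<longrightarrow> {cs ! i, cs ! Suc i} \<in> E) \<and> {last cs, hd cs} \<in> E)"

definition is_tree :: "'a set \<Rightarrow> 'a set set \<Rightarrow> bool" where
  "is_tree V E \<longleftrightarrow> connected_graph V E \<and> \<not> has_cycle V E"

definition fin_separable :: "'a set \<Rightarrow> 'a set set \<Rightarrow> 'a \<Rightarrow> 'a \<Rightarrow> bool" where
  "fin_separable V E x y \<longleftrightarrow> (\<exists>F. F \<subseteq> E \<and> finite F \<and> \<not> reach V (E - F) x y)"

definition omega_edge_blocks :: "'a set \<Rightarrow> 'a set set \<Rightarrow> 'a set set" where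
  "omega_edge_blocks V E = {{y \<in> V. \<not> fin_separable V E x y} | x. x \<in> V}"

definition edges_between :: "'a set set \<Rightarrow> 'a set \<Rightarrow> 'a set \<Rightarrow> 'a set set" where
  "edges_between E A B = {e \<in> E. \<exists>u v. e = {u, v} \<and> u \<in> A \<and> v \<in> B}"

definition tree_cut_decomposition ::
  "'a set \<Rightarrow> 'a set set \<Rightarrow> 'b set \<Rightarrow> 'b set set \<Rightarrow> ('b \<Rightarrow> 'a set) \<Rightarrow> bool" where
  "tree_cut_decomposition V E VT ET X \<longleftrightarrow> is_tree VT ET \<and>
     (\<forall>t\<in>VT. X t \<noteq> {}) \<and>
     (\<forall>t\<in>VT. \<forall>s\<in>VT. t \<noteq> s \<longrightarrow> X t \<inter> X s = {}) \<and>
     (\<Union>t\<in>VT. X t) = V"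

definition adhesion :: "'a set set \<Rightarrow> 'b set \<Rightarrow> 'b set set \<Rightarrow> ('b \<Rightarrow> 'a set) \<Rightarrow> 'b \<Rightarrow> 'b \<Rightarrow> 'a set set" where
  "adhesion E VT ET X t1 t2 =
     edges_between E (\<Union>t\<in>{s. reach VT (ET - {{t1, t2}}) t1 s}. X t)
                     (\<Union>t\<in>{s. reach VT (ET - {{t1, t2}}) t2 s}. X t)"

definition finite_adhesion :: "'a set set \<Rightarrow> 'b set \<Rightarrow> 'b set set \<Rightarrow> ('b \<Rightarrow> 'a set) \<Rightarrow> bool" where
  "finite_adhesion E VT ET X \<longleftrightarrow> (\<forall>t1 t2. {t1, t2} \<in> ET \<longrightarrow> finite (adhesion E VT ET X t1 t2))"

end

theory Submission
  imports Defs
begin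

text \<open>
  Contracting the \<open>\<omega>\<close>-edge blocks gives a connected graph \<open>H\<close> in which any two vertices are separated
  by a finite cut, and it suffices to find a spanning tree \<open>T\<close> of \<open>H\<close> such that every \<open>e \<in> T\<close> is
  the only edge of \<open>T\<close> in some finite cut of \<open>H\<close>: such a cut shows that \<open>e\<close> is a bridge of \<open>T\<close> and
  contains its fundamental cut.

  A finite tree in \<open>H\<close> is grown together with a retraction \<open>r\<close> of \<open>H\<close> onto its vertices that has
  connected fibres and only finitely many edges between different fibres. To add a path inside the
  fibre of \<open>p\<close> starting at \<open>p\<close>, one splits the fibre along a finite cut into two connected pieces, one
  containing \<open>p\<close> and the other the rest of the path. Always adding the ends of
  all edges between fibres, one obtains after \<open>\<omega>\<close> steps a tree whose vertices are pairwise separated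
  by finite cuts of \<open>H\<close> consisting of edges spanned by the tree. Such a closed tree \<open>T\<close> with vertex set \<open>W\<close> has the
  property that each component \<open>C\<close> of \<open>H - W\<close> has a single neighbour \<open>a\<close> in \<open>W\<close>; so \<open>T\<close> can be enlarged by
  a closed tree of \<open>H[C \<union> {a}]\<close> containing \<open>a\<close>, and a maximal closed tree (Zorn) spans \<open>H\<close>.
\<close>

section \<open>Walks, induced edge sets and edge cuts\<close>

text \<open>No vertex set is carried along: for the edges of a graph this agrees with
  \<open>reach\<close> from a vertex, and restriction to a vertex set is expressed through
  \<open>ind\<close>.\<close>

definition conn :: "'a set set \<Rightarrow> 'a \<Rightarrow> 'a \<Rightarrow> bool" where
  "conn F = (\<lambda>u v. {u, v} \<in> F)\<^sup>*\<^sup>*"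

definition ind :: "'a set set \<Rightarrow> 'a set \<Rightarrow> 'a set set" where
  "ind E P = {e \<in> E. e \<subseteq> P}"

text \<open>\<open>A\<close> ranges over all sets of the type, not only over subsets of the vertex
  set, so a side can be exchanged for \<open>- A\<close>.\<close>

definition ecut :: "'a set set \<Rightarrow> 'a set \<Rightarrow> 'a set set" where
  "ecut E A = {e \<in> E. e \<inter> A \<noteq> {} \<and> e - A \<noteq> {}}"

text \<open>The edges that survive when the fibres of \<open>r\<close> are contracted; used for
  retractions onto trees and later for the map from vertices to blocks.\<close>

definition cross :: "'a set set \<Rightarrow> ('a \<Rightarrow> 'b) \<Rightarrow> 'a set set" where
  "cross E r = {e \<in> E. \<exists>u\<in>e. \<exists>v\<in>e. r u \<noteq> r v}"

text \<open>The root \<open>w\<close> is included so that \<open>T = {}\<close> stands for the one-vertex tree.\<close>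
definition vs :: "'a \<Rightarrow> 'a set set \<Rightarrow> 'a set" where
  "vs w T = insert w (\<Union>T)"

definition finsep :: "'a set \<Rightarrow> 'a set set \<Rightarrow> bool" where
  "finsep V E \<longleftrightarrow> (\<forall>x\<in>V. \<forall>y\<in>V. x \<noteq> y \<longrightarrow> (\<exists>A. finite (ecut E A) \<and> x \<in> A \<and> y \<notin> A))"

lemma conn_refl [simp]: "conn F x x"
  by (simp add: conn_def)

lemma conn_step: "conn F x y \<Longrightarrow> {y, z} \<in> F \<Longrightarrow> conn F x z"
  unfolding conn_def by (rule rtranclp.rtrancl_into_rtrancl)

lemma conn_trans: "conn F x y \<Longrightarrow> conn F y z \<Longrightarrow> conn F x z"
  unfolding conn_def by (rule rtranclp_trans)

lemma conn_mono: "conn F x y \<Longrightarrow> F \<subseteq> F' \<Longrightarrow> conn F' x y"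
  unfolding conn_def by (erule rtranclp_mono[THEN predicate2D, rotated]) auto

lemma conn_sym: "conn F x y \<Longrightarrow> conn F y x"
proof -
  have "symp (\<lambda>u v. {u, v} \<in> F)" by (auto intro: sympI simp: insert_commute)
  then show "conn F x y \<Longrightarrow> conn F y x"
    unfolding conn_def by (metis symp_rtranclp sympD)
qed

lemma conn_induct [consumes 1, case_names refl step]:
  assumes "conn F x y" and "P x"
    and "\<And>u v. conn F x u \<Longrightarrow> {u, v} \<in> F \<Longrightarrow> P u \<Longrightarrow> P v"
  shows "P y"
  using assms unfolding conn_def by (induction rule: rtranclp_induct) auto

lemma ind_mono: "P \<subseteq> Q \<Longrightarrow> ind E P \<subseteq> ind E Q"
  by (auto simp: ind_def)

lemma conn_in_ind: "conn (ind E P) x y \<Longrightarrow> x \<in> P \<Longrightarrow> y \<in> P"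
  by (induction rule: conn_induct) (auto simp: ind_def)

lemma conn_in_vs: "conn T w u \<Longrightarrow> u \<in> vs w T"
  by (induction rule: conn_induct) (auto simp: vs_def)

lemma conn_component: "conn (ind E R) q v \<Longrightarrow> conn (ind E {x. conn (ind E R) q x}) q v"
proof (induction rule: conn_induct)
  case (step u v)
  have "conn (ind E R) q v" using step(1,2) by (rule conn_step)
  then have "{u, v} \<in> ind E {x. conn (ind E R) q x}" using step(1,2) by (simp add: ind_def)
  with step show ?case by (blast intro: conn_step)
qed simp

lemma conn_cut: "conn F x y \<Longrightarrow> ecut F A = {} \<Longrightarrow> x \<in> A \<longleftrightarrow> y \<in> A"
  by (induction rule: conn_induct) (auto simp: ecut_def)

lemma ecut_compl: "ecut E (- A) = ecut E A"
  by (auto simp: ecut_def)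

lemma ecut_mono: "F \<subseteq> E \<Longrightarrow> ecut F A \<subseteq> ecut E A"
  by (auto simp: ecut_def)

lemma ecut_singletonD:
  assumes "ecut T A = {e}"
  shows "e \<in> T" "e \<inter> A \<noteq> {}" "e - A \<noteq> {}"
proof -
  have "e \<in> ecut T A" using assms by simp
  then show "e \<in> T" "e \<inter> A \<noteq> {}" "e - A \<noteq> {}" by (simp_all add: ecut_def)
qed

text \<open>With \<open>conn_cut\<close> this turns "only tree edge in a cut" into "bridge": no walk
  in \<open>S\<close> changes sides of \<open>A\<close>.\<close>

lemma ecut_singleton_remove:
  assumes "ecut T A = {e}" "S \<subseteq> T" "e \<notin> S"
  shows "ecut S A = {}"
proof -
  have "ecut S A \<subseteq> {e}" using ecut_mono[OF assms(2), of A] assms(1) by simp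
  moreover have "e \<notin> ecut S A" using assms(3) by (simp add: ecut_def)
  ultimately show ?thesis by blast
qed

lemma graph_edgeE:
  assumes "graph V E" "e \<in> E"
  obtains u v where "u \<noteq> v" "u \<in> V" "v \<in> V" "e = {u, v}"
  using assms unfolding graph_def by blast

lemma ecutE:
  assumes "graph V E" "e \<in> ecut E A"
  obtains u v where "e = {u, v}" "e \<in> E" "u \<in> A" "v \<notin> A" "u \<in> V" "v \<in> V"
proof -
  have "e \<in> E" using assms(2) by (simp add: ecut_def)
  then obtain u v where "u \<noteq> v" "u \<in> V" "v \<in> V" "e = {u, v}"
    using graph_edgeE[OF assms(1)] by metis
  with assms(2) that[of u v] that[of v u] show thesis
    by (cases "u \<in> A") (auto simp: ecut_def insert_commute)
qed

lemma graph_subset: "graph V E \<Longrightarrow> F \<subseteq> E \<Longrightarrow> graph V F"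
  by (auto simp: graph_def)

lemma graph_ind:
  assumes "graph V E"
  shows "graph K (ind E K)"
  unfolding graph_def
proof
  fix e assume "e \<in> ind E K"
  then have "e \<in> E" "e \<subseteq> K" by (auto simp: ind_def)
  moreover from \<open>e \<in> E\<close> obtain u v where "u \<noteq> v" "e = {u, v}"
    using graph_edgeE[OF assms] by metis
  ultimately show "\<exists>u v. u \<noteq> v \<and> u \<in> K \<and> v \<in> K \<and> e = {u, v}" by auto
qed

section \<open>Finite cuts and the splitting of connected sets\<close>

lemma finsepE:
  assumes "finsep V E" "x \<in> V" "y \<in> V" "x \<noteq> y"
  obtains A where "finite (ecut E A)" "x \<in> A" "y \<notin> A"
  using assms unfolding finsep_def by blast

text \<open>An edge leaving \<open>A \<inter> B\<close> leaves \<open>A\<close> or \<open>B\<close>,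
  so the cuts that separate \<open>p\<close> from single vertices of \<open>Q\<close> can be
  intersected.\<close>

lemma finite_cut_avoiding:
  assumes "finsep V E" "p \<in> V" "finite Q" "Q \<subseteq> V" "p \<notin> Q"
  shows "\<exists>A. finite (ecut E A) \<and> p \<in> A \<and> Q \<inter> A = {}"
  using assms(3-5)
proof (induction Q rule: finite_induct)
  case empty
  have "ecut E UNIV = {}" by (auto simp: ecut_def)
  then show ?case by (intro exI[of _ UNIV]) auto
next
  case (insert q Q)
  then obtain A where A: "finite (ecut E A)" "p \<in> A" "Q \<inter> A = {}" by auto
  obtain B where B: "finite (ecut E B)" "p \<in> B" "q \<notin> B"
    using finsepE[OF assms(1,2), of q] insert.prems by auto
  have "ecut E (A \<inter> B) \<subseteq> ecut E A \<union> ecut E B" by (auto simp: ecut_def)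
  with A B have "finite (ecut E (A \<inter> B))" by (meson finite_UnI finite_subset)
  with A B show ?case by (intro exI[of _ "A \<inter> B"]) auto
qed

text \<open>The cut \<open>A\<close> alone may leave many pieces of \<open>P\<close>. Hence take the
  component \<open>B\<close> of \<open>p\<close> in \<open>P \<inter> A\<close> and then the
  component \<open>D\<close> of \<open>q\<close> in \<open>P - B\<close>: edges of \<open>P\<close>
  leaving \<open>D\<close> end in \<open>B\<close> and cross \<open>A\<close>, while all that is
  left of \<open>P\<close> hangs on \<open>B\<close>.\<close>

lemma split_connected:
  assumes g: "graph V E" and P: "\<And>v. v \<in> P \<Longrightarrow> conn (ind E P) p v" "p \<in> P"
    and A: "finite (ecut E A)" "p \<in> A" "Q \<inter> A = {}"
    and Q: "Q \<subseteq> P" "q \<in> Q" "\<And>v. v \<in> Q \<Longrightarrow> conn (ind E Q) q v"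
  obtains D where "D \<subseteq> P" "Q \<subseteq> D" "p \<notin> D"
    "\<And>v. v \<in> D \<Longrightarrow> conn (ind E D) q v"
    "\<And>v. v \<in> P - D \<Longrightarrow> conn (ind E (P - D)) p v"
    "finite (ecut (ind E P) D)"
proof -
  define B where "B = {v. conn (ind E (P \<inter> A)) p v}"
  define D where "D = {v. conn (ind E (P - B)) q v}"
  have B: "B \<subseteq> P \<inter> A" "p \<in> B"
    using conn_in_ind[of E "P \<inter> A" p] P(2) A(2) by (auto simp: B_def)
  have QB: "Q \<subseteq> P - B" using B A(3) Q(1) by blast
  have D: "D \<subseteq> P - B" using conn_in_ind[of E "P - B" q] QB Q(2) by (auto simp: D_def)
  have DB: "v \<in> B" if "{u, v} \<in> ind E P" "u \<in> D" "v \<notin> D" for u v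
  proof (rule ccontr)
    assume "v \<notin> B"
    then have "{u, v} \<in> ind E (P - B)" using that D by (auto simp: ind_def)
    then show False using that by (auto simp: D_def intro: conn_step)
  qed
  have gP: "graph P (ind E P)" using graph_ind[OF g] .
  have "ecut (ind E P) D \<subseteq> ecut E A"
  proof
    fix e assume "e \<in> ecut (ind E P) D"
    then obtain u v where e: "e = {u, v}" "e \<in> ind E P" "u \<in> D" "v \<notin> D"
      by (rule ecutE[OF gP])
    with DB have v: "v \<in> B" by blast
    \<comment> \<open>Otherwise \<open>u\<close>, being adjacent to \<open>B\<close> within
      \<open>P \<inter> A\<close>, would belong to the component \<open>B\<close>.\<close>
    have "u \<notin> A"
    proof
      assume "u \<in> A"
      then have "{v, u} \<in> ind E (P \<inter> A)" using e v B by (auto simp: ind_def insert_commute)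
      then have "u \<in> B" using v by (auto simp: B_def intro: conn_step)
      with e(3) D show False by blast
    qed
    then show "e \<in> ecut E A" using e v B by (auto simp: ecut_def ind_def)
  qed
  then have fin: "finite (ecut (ind E P) D)" using A(1) finite_subset by blast
  have BD: "conn (ind E (P - D)) p v" if "v \<in> B" for v
  proof -
    have "conn (ind E B) p v" using that conn_component[of E "P \<inter> A" p v] by (simp add: B_def)
    moreover have "ind E B \<subseteq> ind E (P - D)" using B D by (intro ind_mono) blast
    ultimately show ?thesis by (rule conn_mono)
  qed
  \<comment> \<open>Follow a walk from \<open>p\<close> in \<open>P\<close>: a step out of
    \<open>D\<close> lands in \<open>B\<close>, which reaches \<open>p\<close> without using
    \<open>D\<close>; a step outside \<open>D\<close> keeps the connection.\<close>
  have "v \<in> D \<or> conn (ind E (P - D)) p v" if "conn (ind E P) p v" for v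
    using that
  proof (induction rule: conn_induct)
    case (step u v)
    show ?case
    proof (cases "v \<in> D \<or> u \<in> D")
      case True
      then show ?thesis using DB[of u v] step BD by blast
    next
      case False
      then have "{u, v} \<in> ind E (P - D)" using step(2) by (auto simp: ind_def)
      with step False show ?thesis by (blast intro: conn_step)
    qed
  qed simp
  then have PD: "conn (ind E (P - D)) p v" if "v \<in> P - D" for v using that P(1) by blast
  have "Q \<subseteq> D"
    unfolding D_def using conn_mono[OF Q(3) ind_mono[OF QB]] by blast
  moreover have "conn (ind E D) q v" if "v \<in> D" for v
    using that conn_component[of E "P - B" q v] by (simp add: D_def)
  ultimately show thesis using that[of D] D B PD fin by blast
qed

section \<open>Growing a finite tree together with a retraction\<close>

text \<open>The fibres of \<open>r\<close> are the connected territories of the tree vertices. The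
  last clause certifies each tree edge as a bridge by a cut taken from the finite set
  \<open>cross E r\<close>.\<close>

definition stage :: "'a set \<Rightarrow> 'a set set \<Rightarrow> 'a \<Rightarrow> 'a set set \<Rightarrow> ('a \<Rightarrow> 'a) \<Rightarrow> bool" where
  "stage V E w T r \<longleftrightarrow> T \<subseteq> E \<and> (\<forall>u\<in>vs w T. conn T w u) \<and>
     (\<forall>v\<in>V. r v \<in> vs w T) \<and> (\<forall>u\<in>vs w T. r u = u) \<and> finite (cross E r) \<and>
     (\<forall>v\<in>V. conn (ind E {x \<in> V. r x = r v}) (r v) v) \<and>
     (\<forall>e\<in>T. \<exists>A. ecut E A \<subseteq> cross E r \<and> ecut T A = {e})"

text \<open>The last conjunct makes new tree edges run inside fibres of \<open>r\<close>; a cut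
  contained in \<open>cross E r\<close> thus never gains a tree edge, which is
  \<open>ext_cut\<close>.\<close>

definition ext :: "'a set set \<Rightarrow> 'a set set \<Rightarrow> ('a \<Rightarrow> 'a) \<Rightarrow> 'a set set \<Rightarrow> ('a \<Rightarrow> 'a) \<Rightarrow> bool" where
  "ext E T r T' r' \<longleftrightarrow> T \<subseteq> T' \<and> cross E r \<subseteq> cross E r' \<and> T' \<inter> cross E r \<subseteq> T"

lemma ext_refl: "ext E T r T r"
  by (auto simp: ext_def)

lemma ext_trans: "ext E T r T' r' \<Longrightarrow> ext E T' r' T'' r'' \<Longrightarrow> ext E T r T'' r''"
  unfolding ext_def by (intro conjI; fast)

lemma vs_mono: "T \<subseteq> T' \<Longrightarrow> vs w T \<subseteq> vs w T'"
  by (auto simp: vs_def)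

lemma vs_subset:
  assumes "graph V E" "T \<subseteq> E" "w \<in> V"
  shows "vs w T \<subseteq> V"
proof -
  have "e \<subseteq> V" if "e \<in> E" for e using that by (auto elim!: graph_edgeE[OF assms(1)])
  then show ?thesis using assms(2,3) unfolding vs_def by blast
qed

lemma ext_cut:
  assumes "T' \<subseteq> E" "ecut E A \<subseteq> cross E r" "ecut T A = {e}" "ext E T r T' r'"
  shows "ecut E A \<subseteq> cross E r'" "ecut T' A = {e}"
proof -
  show "ecut E A \<subseteq> cross E r'" using assms by (auto simp: ext_def)
  have "ecut T' A \<subseteq> ecut T A"
    using assms(1,2,4) by (force simp: ext_def ecut_def)
  moreover have "ecut T A \<subseteq> ecut T' A" using assms(4) by (auto simp: ext_def ecut_def)
  ultimately show "ecut T' A = {e}" using assms(3) by blast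
qed

text \<open>The fibre of \<open>p\<close> is split into territories of \<open>p\<close> and of the
  new vertex \<open>q\<close>. The set \<open>Q\<close>, the part still to be explored, goes to
  \<open>q\<close> as a whole, so that the process can continue from \<open>q\<close>.\<close>

lemma stage_step:
  assumes g: "graph V E" and fs: "finsep V E" and w: "w \<in> V"
    and st: "stage V E w T r" and p: "p \<in> vs w T" and pq: "{p, q} \<in> E"
    and Q: "finite Q" "Q \<subseteq> V" "q \<in> Q" "p \<notin> Q" "\<And>v. v \<in> Q \<Longrightarrow> r v = p"
      "\<And>v. v \<in> Q \<Longrightarrow> conn (ind E Q) q v"
  obtains T' r' where "stage V E w T' r'" "ext E T r T' r'" "\<And>v. v \<in> Q \<Longrightarrow> r' v = q" "q \<in> vs w T'"
proof -
  have T: "T \<subseteq> E" and Tc: "\<And>u. u \<in> vs w T \<Longrightarrow> conn T w u"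
    and r1: "\<And>v. v \<in> V \<Longrightarrow> r v \<in> vs w T" and r2: "\<And>u. u \<in> vs w T \<Longrightarrow> r u = u"
    and fin: "finite (cross E r)"
    and rc: "\<And>v. v \<in> V \<Longrightarrow> conn (ind E {x \<in> V. r x = r v}) (r v) v"
    and Tcut: "\<And>e. e \<in> T \<Longrightarrow> \<exists>A. ecut E A \<subseteq> cross E r \<and> ecut T A = {e}"
    using st unfolding stage_def by blast+
  define P where "P = {x \<in> V. r x = p}"
  have vsV: "vs w T \<subseteq> V" using vs_subset[OF g T w] .
  have pP: "p \<in> P" using p r2 vsV by (auto simp: P_def)
  have Pc: "conn (ind E P) p v" if "v \<in> P" for v using rc[of v] that by (simp add: P_def)
  have QP: "Q \<subseteq> P" using Q by (auto simp: P_def)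
  obtain A where A: "finite (ecut E A)" "p \<in> A" "Q \<inter> A = {}"
    using finite_cut_avoiding[OF fs _ Q(1,2,4)] pP by (auto simp: P_def)
  obtain D where D: "D \<subseteq> P" "Q \<subseteq> D" "p \<notin> D"
    "\<And>v. v \<in> D \<Longrightarrow> conn (ind E D) q v"
    "\<And>v. v \<in> P - D \<Longrightarrow> conn (ind E (P - D)) p v" "finite (ecut (ind E P) D)"
    using split_connected[OF g Pc pP A QP Q(3,6)] by metis
  define T' where "T' = insert {p, q} T"
  define r' where "r' = (\<lambda>v. if v \<in> D then q else r v)"
  have qD: "q \<in> D" using D Q by blast
  have vsT': "vs w T' = insert q (vs w T)" using p by (auto simp: T'_def vs_def)
  have Dvs: "D \<inter> vs w T = {}" using D(1,3) r2 by (auto simp: P_def)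
  have q_vs: "q \<notin> vs w T" using Dvs qD by blast
  have rD: "r v = p" if "v \<in> D" for v using that D(1) by (auto simp: P_def)
  \<comment> \<open>The values of \<open>r\<close> lie in the old tree, which omits
    \<open>q\<close>, so giving \<open>D\<close> the value \<open>q\<close> refines the fibres and
    merges none.\<close>
  have cross_sub: "cross E r \<subseteq> cross E r'"
  proof
    fix e assume "e \<in> cross E r"
    then obtain u v where e: "e \<in> E" "u \<in> e" "v \<in> e" "r u \<noteq> r v" by (auto simp: cross_def)
    have "e \<subseteq> V" using g e(1) by (auto simp: graph_def)
    then have "r u \<noteq> q" "r v \<noteq> q" using e r1 q_vs by (auto)
    then have "r' u \<noteq> r' v" using e(4) rD by (auto simp: r'_def)
    with e show "e \<in> cross E r'" by (auto simp: cross_def)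
  qed
  have cross': "cross E r' \<subseteq> cross E r \<union> ecut (ind E P) D"
  proof
    fix e assume "e \<in> cross E r'"
    then obtain u v where e: "e \<in> E" "u \<in> e" "v \<in> e" "r' u \<noteq> r' v" by (auto simp: cross_def)
    have eV: "e \<subseteq> V" using g e(1) by (auto simp: graph_def)
    show "e \<in> cross E r \<union> ecut (ind E P) D"
    proof (cases "e \<in> cross E r")
      case False
      then have eq: "\<And>a b. a \<in> e \<Longrightarrow> b \<in> e \<Longrightarrow> r a = r b" using e(1) unfolding cross_def by blast
      have uv: "(u \<in> D) \<noteq> (v \<in> D)" using e(4) eq[OF e(2,3)] by (cases "u \<in> D"; cases "v \<in> D") (simp_all add: r'_def)
      have "r a = p" if "a \<in> e" for a using rD[of u] rD[of v] eq[OF that e(2)] eq[OF that e(3)] uv by metis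
      then have "e \<subseteq> P" using eV by (auto simp: P_def)
      then show ?thesis using e uv by (auto simp: ecut_def ind_def)
    qed simp
  qed
  \<comment> \<open>Both ends of the new edge \<open>{p, q}\<close> have \<open>r\<close>-value
    \<open>p\<close>, so this edge is not in \<open>cross E r\<close>.\<close>
  have ex: "ext E T r T' r'"
    unfolding ext_def
    using cross_sub Q(3,5) r2[OF p] by (auto simp: T'_def cross_def)
  have T'E: "T' \<subseteq> E" using T pq by (auto simp: T'_def)
  have "stage V E w T' r'"
    unfolding stage_def
  proof (intro conjI ballI)
    show "T' \<subseteq> E" by fact
    fix u assume "u \<in> vs w T'"
    then consider "u = q" | "u \<in> vs w T" using vsT' by auto
    then show "conn T' w u"
    proof cases
      case 1
      have "conn T' w p" using conn_mono[OF Tc[OF p], of T'] by (auto simp: T'_def)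
      then show ?thesis unfolding 1 by (rule conn_step) (simp add: T'_def)
    next
      case 2
      then show ?thesis using conn_mono[OF Tc, of u T'] by (auto simp: T'_def)
    qed
  next
    fix v assume "v \<in> V" then show "r' v \<in> vs w T'" using r1 vsT' by (auto simp: r'_def)
  next
    fix u assume "u \<in> vs w T'"
    then show "r' u = u" using vsT' r2 Dvs qD by (auto simp: r'_def)
  next
    show "finite (cross E r')" using cross' fin D(6) by (meson finite_UnI finite_subset)
  next
    fix v assume v: "v \<in> V"
    consider "v \<in> D" | "v \<in> P - D" | "v \<notin> P" by blast
    then show "conn (ind E {x \<in> V. r' x = r' v}) (r' v) v"
    proof cases
      case 1
      have "D \<subseteq> {x \<in> V. r' x = r' v}" using 1 D(1) by (auto simp: r'_def P_def)
      moreover have "r' v = q" using 1 by (simp add: r'_def)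
      ultimately show ?thesis using conn_mono[OF D(4)[OF 1] ind_mono] by simp
    next
      case 2
      then have "r' v = p" by (auto simp: r'_def P_def)
      moreover have "P - D \<subseteq> {x \<in> V. r' x = p}" by (auto simp: r'_def P_def)
      ultimately show ?thesis using conn_mono[OF D(5)[OF 2] ind_mono] by simp
    next
      case 3
      then have "r' v = r v" using D(1) by (auto simp: r'_def)
      moreover have "{x \<in> V. r x = r v} \<subseteq> {x \<in> V. r' x = r v}"
        using 3 v D(1) by (auto simp: r'_def P_def)
      ultimately show ?thesis using conn_mono[OF rc[OF v] ind_mono] by simp
    qed
  next
    fix e assume "e \<in> T'"
    then consider "e = {p, q}" | "e \<in> T" by (auto simp: T'_def)
    then show "\<exists>A. ecut E A \<subseteq> cross E r' \<and> ecut T' A = {e}"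
    proof cases
      case 1
      \<comment> \<open>On \<open>V\<close>, the set \<open>D\<close> is the fibre of
        \<open>r'\<close> over \<open>q\<close>. It contains no old tree vertex, so
        \<open>{p, q}\<close> is the only tree edge leaving it.\<close>
      have "ecut E D \<subseteq> cross E r'"
      proof
        fix e assume "e \<in> ecut E D"
        then obtain u v where e: "e = {u, v}" "e \<in> E" "u \<in> D" "v \<notin> D" "v \<in> V" by (rule ecutE[OF g])
        then have "r' u = q" "r' v \<noteq> q" using r1[of v] q_vs by (auto simp: r'_def)
        with e show "e \<in> cross E r'" by (auto simp: cross_def)
      qed
      moreover have "ecut T' D = {e}"
      proof -
        have "ecut T D = {}" using Dvs by (auto simp: ecut_def vs_def)
        moreover have "ecut T' D \<subseteq> insert {p,q} (ecut T D)" by (auto simp: ecut_def T'_def)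
        moreover have "{p, q} \<in> ecut T' D" using D(3) qD by (auto simp: ecut_def T'_def)
        ultimately show ?thesis using 1 by blast
      qed
      ultimately show ?thesis by blast
    next
      case 2
      then show ?thesis using Tcut[OF 2] ext_cut[OF T'E _ _ ex] by metis
    qed
  qed
  moreover have "r' v = q" if "v \<in> Q" for v using that D(2) by (auto simp: r'_def)
  ultimately show thesis using that[of T' r'] ex vsT' by blast
qed

text \<open>Take for \<open>q\<close> the successor of the last visit to \<open>p\<close>; in the
  induction every step out of \<open>p\<close> restarts the walk.\<close>

lemma conn_avoid_start:
  assumes "conn (ind E Q) p v" "v \<noteq> p"
  shows "\<exists>q \<in> Q - {p}. {p, q} \<in> E \<and> conn (ind E (Q - {p})) q v"
proof -
  have "v \<noteq> p \<longrightarrow> (\<exists>q \<in> Q - {p}. {p, q} \<in> E \<and> conn (ind E (Q - {p})) q v)"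
    using assms(1)
  proof (induction rule: conn_induct)
    case (step u v)
    show ?case
    proof (intro impI, cases "u = p")
      case True
      assume "v \<noteq> p"
      with True step(2) show "\<exists>q \<in> Q - {p}. {p, q} \<in> E \<and> conn (ind E (Q - {p})) q v"
        by (intro bexI[of _ v]) (auto simp: ind_def)
    next
      case False
      assume "v \<noteq> p"
      then have "{u, v} \<in> ind E (Q - {p})" using False step(2) by (auto simp: ind_def)
      with False step(3) show "\<exists>q \<in> Q - {p}. {p, q} \<in> E \<and> conn (ind E (Q - {p})) q v"
        by (blast intro: conn_step)
    qed
  qed simp
  with assms(2) show ?thesis by blast
qed

text \<open>Induction on \<open>card Q\<close>: one \<open>stage_step\<close> moves from
  \<open>p\<close> to a neighbour \<open>q\<close> and hands \<open>q\<close> a smaller connected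
  set that still contains \<open>v\<close>.\<close>

lemma stage_absorb_connected:
  assumes g: "graph V E" and fs: "finsep V E" and w: "w \<in> V"
    and "stage V E w T r" "finite Q" "Q \<subseteq> V" "p \<in> Q" "p \<in> vs w T" "v \<in> Q"
      "\<And>x. x \<in> Q \<Longrightarrow> r x = p" "\<And>x. x \<in> Q \<Longrightarrow> conn (ind E Q) p x"
  shows "\<exists>T' r'. stage V E w T' r' \<and> ext E T r T' r' \<and> v \<in> vs w T'"
  using assms(4-)
proof (induction "card Q" arbitrary: Q T r p rule: less_induct)
  case less
  show ?case
  proof (cases "v = p")
    case True
    then show ?thesis using less.prems ext_refl by blast
  next
    case False
    then obtain q where q: "q \<in> Q - {p}" "{p, q} \<in> E" "conn (ind E (Q - {p})) q v"
      using conn_avoid_start less.prems(6,8) by metis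
    \<comment> \<open>Deleting \<open>p\<close> may disconnect \<open>Q\<close>; only the component
      containing both \<open>q\<close> and \<open>v\<close> is pursued.\<close>
    define R where "R = {x. conn (ind E (Q - {p})) q x}"
    have R: "R \<subseteq> Q - {p}" unfolding R_def using conn_in_ind q(1) by fast
    have Rc: "conn (ind E R) q x" if "x \<in> R" for x
      using that conn_component[of E "Q - {p}" q x] by (simp add: R_def)
    have "finite R" "R \<subseteq> V" "q \<in> R" "p \<notin> R" "v \<in> R"
      using R less.prems(2,3) q(3) finite_subset[of R Q] unfolding R_def by simp_all blast+
    moreover have "r x = p" if "x \<in> R" for x using that R less.prems(7) by blast
    ultimately obtain T1 r1 where 1: "stage V E w T1 r1" "ext E T r T1 r1"
      "\<And>x. x \<in> R \<Longrightarrow> r1 x = q" "q \<in> vs w T1"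
      using stage_step[OF g fs w less.prems(1,5) q(2) _ _ _ _ _ Rc] by metis
    have "card R < card Q" using R less.prems(2,4) by (intro psubset_card_mono) auto
    then have "\<exists>T' r'. stage V E w T' r' \<and> ext E T1 r1 T' r' \<and> v \<in> vs w T'"
      using less.hyps[of R T1 r1 q] 1 Rc \<open>finite R\<close> \<open>R \<subseteq> V\<close> \<open>q \<in> R\<close> \<open>v \<in> R\<close> by blast
    then show ?thesis using ext_trans[OF 1(2)] by blast
  qed
qed

text \<open>The vertices of a walk from \<open>p\<close> to \<open>v\<close> form such a
  \<open>Q\<close>; its finiteness feeds the induction on \<open>card Q\<close>.\<close>

lemma conn_finite_set:
  assumes "conn (ind E P) p v" "p \<in> P"
  shows "\<exists>Q. finite Q \<and> Q \<subseteq> P \<and> p \<in> Q \<and> v \<in> Q \<and> (\<forall>x\<in>Q. conn (ind E Q) p x)"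
  using assms(1)
proof (induction rule: conn_induct)
  case refl
  show ?case using assms(2) by (intro exI[of _ "{p}"]) auto
next
  case (step u v)
  then obtain Q where Q: "finite Q" "Q \<subseteq> P" "p \<in> Q" "u \<in> Q" "\<And>x. x \<in> Q \<Longrightarrow> conn (ind E Q) p x"
    by blast
  have c: "conn (ind E (insert v Q)) p x" if "x \<in> Q" for x
    using conn_mono[OF Q(5)[OF that] ind_mono] by blast
  moreover have "{u, v} \<in> ind E (insert v Q)" using step(2) Q(4) by (auto simp: ind_def)
  then have "conn (ind E (insert v Q)) p v" using c[OF Q(4)] by (blast intro: conn_step)
  ultimately show ?case using Q step(2) by (intro exI[of _ "insert v Q"]) (auto simp: ind_def)
qed

lemma stage_absorb_vertex:
  assumes g: "graph V E" and fs: "finsep V E" and w: "w \<in> V"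
    and st: "stage V E w T r" and v: "v \<in> V"
  shows "\<exists>T' r'. stage V E w T' r' \<and> ext E T r T' r' \<and> v \<in> vs w T'"
proof -
  let ?P = "{x \<in> V. r x = r v}"
  have r: "r v \<in> vs w T" "r (r v) = r v" and c: "conn (ind E ?P) (r v) v" and T: "T \<subseteq> E"
    using st v unfolding stage_def by auto
  have "r v \<in> ?P" using r vs_subset[OF g T w] by auto
  from conn_finite_set[OF c this] obtain Q where
    Q: "finite Q" "Q \<subseteq> ?P" "r v \<in> Q" "v \<in> Q" "\<forall>x\<in>Q. conn (ind E Q) (r v) x" by blast
  show ?thesis
    by (rule stage_absorb_connected[OF g fs w st Q(1) _ Q(3) r(1) Q(4)]) (use Q in auto)
qed

lemma stage_absorb_finite:
  assumes g: "graph V E" and fs: "finsep V E" and w: "w \<in> V"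
    and st: "stage V E w T r" and Z: "finite Z" "Z \<subseteq> V"
  shows "\<exists>T' r'. stage V E w T' r' \<and> ext E T r T' r' \<and> Z \<subseteq> vs w T'"
  using Z
proof (induction Z rule: finite_induct)
  case empty
  then show ?case using st ext_refl by blast
next
  case (insert z Z)
  then obtain T1 r1 where 1: "stage V E w T1 r1" "ext E T r T1 r1" "Z \<subseteq> vs w T1" by auto
  obtain T2 r2 where 2: "stage V E w T2 r2" "ext E T1 r1 T2 r2" "z \<in> vs w T2"
    using stage_absorb_vertex[OF g fs w 1(1)] insert.prems by blast
  have "vs w T1 \<subseteq> vs w T2" using 2(2) by (intro vs_mono) (simp add: ext_def)
  then show ?case using 1 2 ext_trans[OF 1(2) 2(2)] by blast
qed

section \<open>Closed trees and unions of chains\<close>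

text \<open>Closedness means that all certifying cuts use only edges spanned by
  \<open>vs w T\<close>; a walk using no such edge therefore cannot change sides of any of
  them.\<close>

definition closed_tree :: "'a set set \<Rightarrow> 'a \<Rightarrow> 'a set set \<Rightarrow> bool" where
  "closed_tree E w T \<longleftrightarrow> T \<subseteq> E \<and> (\<forall>u\<in>vs w T. conn T w u) \<and>
     (\<forall>e\<in>T. \<exists>A. finite (ecut E A) \<and> ecut E A \<subseteq> ind E (vs w T) \<and> ecut T A = {e}) \<and>
     (\<forall>x\<in>vs w T. \<forall>y\<in>vs w T. x \<noteq> y \<longrightarrow>
        (\<exists>A. finite (ecut E A) \<and> ecut E A \<subseteq> ind E (vs w T) \<and> x \<in> A \<and> y \<notin> A))"

lemma closed_tree_subset: "closed_tree E w T \<Longrightarrow> T \<subseteq> E"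
  by (simp add: closed_tree_def)

lemma closed_tree_conn: "closed_tree E w T \<Longrightarrow> u \<in> vs w T \<Longrightarrow> conn T w u"
  by (simp add: closed_tree_def)

lemma closed_tree_cutE:
  assumes "closed_tree E w T" "e \<in> T"
  obtains A where "finite (ecut E A)" "ecut E A \<subseteq> ind E (vs w T)" "ecut T A = {e}"
proof -
  have "\<exists>A. finite (ecut E A) \<and> ecut E A \<subseteq> ind E (vs w T) \<and> ecut T A = {e}"
    using assms by (simp add: closed_tree_def)
  with that show thesis by metis
qed

lemma closed_tree_sepE:
  assumes "closed_tree E w T" "x \<in> vs w T" "y \<in> vs w T" "x \<noteq> y"
  obtains A where "finite (ecut E A)" "ecut E A \<subseteq> ind E (vs w T)" "x \<in> A" "y \<notin> A"
proof -
  have "\<exists>A. finite (ecut E A) \<and> ecut E A \<subseteq> ind E (vs w T) \<and> x \<in> A \<and> y \<notin> A"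
    using assms by (simp add: closed_tree_def)
  with that show thesis by metis
qed

text \<open>Dependent choice gives stages, each absorbing all ends of the crossing edges of its
  predecessor. The cuts certified at any stage are then spanned by the union of the trees.\<close>

lemma closed_tree_containing:
  assumes g: "graph V E" and fs: "finsep V E" and w: "w \<in> V" and c: "c \<in> V"
    and con: "\<And>v. v \<in> V \<Longrightarrow> conn E w v"
  shows "\<exists>S. closed_tree E w S \<and> c \<in> vs w S"
proof -
  let ?st = "\<lambda>\<sigma>. stage V E w (fst \<sigma>) (snd \<sigma>)"
  let ?next = "\<lambda>\<sigma> \<sigma>'. ext E (fst \<sigma>) (snd \<sigma>) (fst \<sigma>') (snd \<sigma>') \<and>
     insert c (\<Union>(cross E (snd \<sigma>))) \<subseteq> vs w (fst \<sigma>')"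
  have iV: "ind E V = E" using g by (auto simp: ind_def graph_def)
  \<comment> \<open>The one-vertex tree with all of \<open>V\<close> as its single fibre, so that no
    edge crosses.\<close>
  have s0: "?st ({}, \<lambda>_. w)"
    unfolding stage_def using con by (auto simp: vs_def cross_def iV)
  have "\<exists>f. \<forall>n. ?st (f n) \<and> ?next (f n) (f (Suc n))"
  proof (rule dependent_nat_choice)
    show "\<exists>\<sigma>. ?st \<sigma>" using s0 by blast
  next
    fix \<sigma> :: "'a set set \<times> ('a \<Rightarrow> 'a)" and n :: nat
    assume st: "?st \<sigma>"
    have fin: "finite (cross E (snd \<sigma>))" using st by (simp add: stage_def)
    have "finite e \<and> e \<subseteq> V" if "e \<in> cross E (snd \<sigma>)" for e
      using that g by (auto simp: cross_def graph_def)
    then have "finite (insert c (\<Union>(cross E (snd \<sigma>))))" "insert c (\<Union>(cross E (snd \<sigma>))) \<subseteq> V"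
      using fin c by auto
    from stage_absorb_finite[OF g fs w st this]
    show "\<exists>\<sigma>'. ?st \<sigma>' \<and> ?next \<sigma> \<sigma>'" by simp
  qed
  then obtain f where f: "\<And>n. ?st (f n)" "\<And>n. ?next (f n) (f (Suc n))" by blast
  define T where "T = (\<lambda>n. fst (f n))"
  define r where "r = (\<lambda>n. snd (f n))"
  have st: "stage V E w (T n) (r n)" for n using f(1) by (simp add: T_def r_def)
  have ex1: "ext E (T n) (r n) (T (Suc n)) (r (Suc n))" for n
    using f(2)[of n] by (simp add: T_def r_def)
  have ex: "ext E (T n) (r n) (T m) (r m)" if "n \<le> m" for n m
    using that by (induction rule: dec_induct) (auto intro: ext_refl ext_trans ex1)
  have Tmono: "T n \<subseteq> T m" if "n \<le> m" for n m using ex[OF that] by (simp add: ext_def)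
  define S where "S = (\<Union>n. T n)"
  have TE: "T n \<subseteq> E" for n using st[of n] by (simp add: stage_def)
  have vsS: "vs w S = (\<Union>n. vs w (T n))" by (auto simp: vs_def S_def)
  have crossS: "cross E (r n) \<subseteq> ind E (vs w S)" for n
  proof
    fix e assume e: "e \<in> cross E (r n)"
    then have "e \<subseteq> vs w (T (Suc n))" using f(2)[of n] by (auto simp: T_def r_def)
    with e vsS show "e \<in> ind E (vs w S)" by (auto simp: ind_def cross_def)
  qed
  have fin: "finite (cross E (r n))" for n using st[of n] by (simp add: stage_def)
  have "closed_tree E w S"
    unfolding closed_tree_def
  proof (intro conjI ballI impI)
    show "S \<subseteq> E" using TE by (auto simp: S_def)
    fix u assume "u \<in> vs w S"
    then obtain n where "u \<in> vs w (T n)" using vsS by blast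
    then have "conn (T n) w u" using st[of n] by (simp add: stage_def)
    then show "conn S w u" by (rule conn_mono) (auto simp: S_def)
  next
    fix e assume "e \<in> S"
    then obtain n where "e \<in> T n" by (auto simp: S_def)
    then obtain A where A: "ecut E A \<subseteq> cross E (r n)" "ecut (T n) A = {e}"
      using st[of n] by (auto simp: stage_def)
    \<comment> \<open>Compare with the later stage \<open>max n m\<close>: it extends stage
      \<open>n\<close>, so \<open>A\<close> still meets its tree in \<open>e\<close> alone.\<close>
    have "ecut (T m) A \<subseteq> {e}" for m
    proof -
      have "ecut (T (max n m)) A = {e}" using ext_cut(2)[OF TE A ex] by simp
      then show ?thesis using ecut_mono[OF Tmono[of m "max n m"], of A] by simp
    qed
    moreover have "ecut S A = (\<Union>m. ecut (T m) A)" by (auto simp: ecut_def S_def)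
    moreover have "ecut (T n) A \<subseteq> ecut S A" by (rule ecut_mono) (auto simp: S_def)
    ultimately have "ecut S A = {e}" using A(2) by (simp add: subset_antisym UN_least)
    then show "\<exists>A. finite (ecut E A) \<and> ecut E A \<subseteq> ind E (vs w S) \<and> ecut S A = {e}"
      using finite_subset[OF A(1) fin] subset_trans[OF A(1) crossS] by blast
  next
    fix x y assume xy: "x \<in> vs w S" "y \<in> vs w S" "x \<noteq> y"
    then obtain n m where nm: "x \<in> vs w (T n)" "y \<in> vs w (T m)" using vsS by blast
    define k where "k = max n m"
    have k: "x \<in> vs w (T k)" "y \<in> vs w (T k)"
      using nm vs_mono[OF Tmono[of n k], of w] vs_mono[OF Tmono[of m k], of w] by (auto simp: k_def)
    then have rk: "r k x = x" "r k y = y" using st[of k] by (auto simp: stage_def)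
    \<comment> \<open>The fibre over \<open>x\<close> at a stage whose tree contains both vertices:
      \<open>r k\<close> fixes \<open>y\<close>, so \<open>y\<close> is outside.\<close>
    let ?A = "{v. r k v = x}"
    have A: "ecut E ?A \<subseteq> cross E (r k)" by (auto simp: ecut_def cross_def)
    show "\<exists>A. finite (ecut E A) \<and> ecut E A \<subseteq> ind E (vs w S) \<and> x \<in> A \<and> y \<notin> A"
      using finite_subset[OF A fin] subset_trans[OF A crossS] rk xy(3)
      by (intro exI[of _ ?A]) simp
  qed
  moreover have "c \<in> vs w S" using f(2)[of 0] vsS by (auto simp: T_def)
  ultimately show ?thesis by blast
qed

text \<open>A closed cut for \<open>e\<close> in \<open>T\<close> has all its edges inside
  \<open>vs w T\<close>, where larger trees of the chain have no edges beyond those of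
  \<open>T\<close>; so it remains a cut for \<open>e\<close> in the union.\<close>

lemma closed_tree_Union:
  assumes ne: "\<C> \<noteq> {}" and C: "\<And>T. T \<in> \<C> \<Longrightarrow> closed_tree E w T"
    and chain: "\<And>S T. S \<in> \<C> \<Longrightarrow> T \<in> \<C> \<Longrightarrow> S \<subseteq> T \<or> T \<subseteq> S"
  shows "closed_tree E w (\<Union>\<C>)"
proof -
  \<comment> \<open>Nonemptiness of \<open>\<C>\<close> puts the root \<open>w\<close> into the
    right-hand side.\<close>
  have vsU: "vs w (\<Union>\<C>) = (\<Union>T\<in>\<C>. vs w T)" using ne by (auto simp: vs_def)
  have indU: "ind E (vs w T) \<subseteq> ind E (vs w (\<Union>\<C>))" if "T \<in> \<C>" for T
    using that by (intro ind_mono vs_mono) blast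
  show ?thesis
    unfolding closed_tree_def
  proof (intro conjI ballI impI)
    show "\<Union>\<C> \<subseteq> E" using closed_tree_subset[OF C] by blast
  next
    fix u assume "u \<in> vs w (\<Union>\<C>)"
    then obtain T where T: "T \<in> \<C>" "u \<in> vs w T" using vsU by blast
    show "conn (\<Union>\<C>) w u"
      by (rule conn_mono[OF closed_tree_conn[OF C[OF T(1)] T(2)]]) (use T in blast)
  next
    fix e assume "e \<in> \<Union>\<C>"
    then obtain T where T: "T \<in> \<C>" "e \<in> T" by blast
    then obtain A where A: "finite (ecut E A)" "ecut E A \<subseteq> ind E (vs w T)" "ecut T A = {e}"
      using closed_tree_cutE[OF C] by metis
    \<comment> \<open>An edge of a larger tree that joins two vertices of \<open>T\<close> lies in \<open>T\<close>:
        its cut in the larger tree would miss \<open>T\<close>, which connects its ends.\<close>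
    have in_T: "f \<in> T" if S: "S \<in> \<C>" "T \<subseteq> S" and f: "f \<in> S" "f \<subseteq> vs w T" for f S
    proof (rule ccontr)
      assume "f \<notin> T"
      obtain B where B: "ecut S B = {f}" using closed_tree_cutE[OF C[OF S(1)] f(1)] .
      have fB: "f \<inter> B \<noteq> {}" "f - B \<noteq> {}" using ecut_singletonD[OF B] by simp_all
      have TB: "ecut T B = {}" using ecut_singleton_remove[OF B S(2) \<open>f \<notin> T\<close>] .
      have "w \<in> B \<longleftrightarrow> x \<in> B" if "x \<in> f" for x
        using closed_tree_conn[OF C[OF T(1)]] f(2) that by (intro conn_cut[OF _ TB]) blast
      with fB show False by blast
    qed
    have "ecut S A \<subseteq> {e}" if S: "S \<in> \<C>" for S
    proof (cases "S \<subseteq> T")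
      case True
      then show ?thesis using ecut_mono[OF True, of A] A(3) by simp
    next
      case False
      then have TS: "T \<subseteq> S" using chain[OF T(1) S] by blast
      have "ecut S A \<subseteq> ecut T A"
      proof
        fix f assume f: "f \<in> ecut S A"
        then have "f \<in> ind E (vs w T)"
          using ecut_mono[OF closed_tree_subset[OF C[OF S]], of A] A(2) by blast
        then have "f \<in> T" using in_T[OF S TS, of f] f by (simp add: ecut_def ind_def)
        then show "f \<in> ecut T A" using f by (simp add: ecut_def)
      qed
      then show ?thesis using A(3) by simp
    qed
    moreover have "ecut (\<Union>\<C>) A = (\<Union>S\<in>\<C>. ecut S A)" by (auto simp: ecut_def)
    moreover have "ecut T A \<subseteq> ecut (\<Union>\<C>) A" by (rule ecut_mono) (use T in blast)
    ultimately have "ecut (\<Union>\<C>) A = {e}" using A(3) by (simp add: subset_antisym UN_least)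
    then show "\<exists>A. finite (ecut E A) \<and> ecut E A \<subseteq> ind E (vs w (\<Union>\<C>)) \<and> ecut (\<Union>\<C>) A = {e}"
      using A indU[OF T(1)] by blast
  next
    fix x y assume xy: "x \<in> vs w (\<Union>\<C>)" "y \<in> vs w (\<Union>\<C>)" "x \<noteq> y"
    then obtain S T where "S \<in> \<C>" "T \<in> \<C>" "x \<in> vs w S" "y \<in> vs w T" using vsU by blast
    then obtain R where R: "R \<in> \<C>" "x \<in> vs w R" "y \<in> vs w R"
      using chain[of S T] vs_mono[of S T w] vs_mono[of T S w] by blast
    obtain A where "finite (ecut E A)" "ecut E A \<subseteq> ind E (vs w R)" "x \<in> A" "y \<notin> A"
      using closed_tree_sepE[OF C[OF R(1)] R(2,3) xy(3)] .
    then show "\<exists>A. finite (ecut E A) \<and> ecut E A \<subseteq> ind E (vs w (\<Union>\<C>)) \<and> x \<in> A \<and> y \<notin> A"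
      using indU[OF R(1)] by blast
  qed
qed

section \<open>Enlarging a closed tree to a spanning tree\<close>

text \<open>A component \<open>C\<close> outside the tree attaches at one vertex \<open>a\<close>
  only, so a closed tree of the subgraph on \<open>insert a C\<close> meets the old tree just in
  \<open>a\<close>. Old cuts contain no edge of the new tree, and new cuts can be taken inside
  \<open>C\<close>, away from the old tree.\<close>

lemma closed_tree_extend:
  assumes g: "graph V E" and fs: "finsep V E" and w: "w \<in> V"
    and con: "\<And>v. v \<in> V \<Longrightarrow> conn E w v"
    and ct: "closed_tree E w T" and ne: "vs w T \<noteq> V"
  shows "\<exists>T'. closed_tree E w T' \<and> T \<subset> T'"
proof -
  define W where "W = vs w T"
  have TE: "T \<subseteq> E" using closed_tree_subset[OF ct] .
  have WV: "W \<subseteq> V" unfolding W_def using vs_subset[OF g TE w] .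
  have wW: "w \<in> W" by (simp add: W_def vs_def)
  have TW: "e \<subseteq> W" if "e \<in> T" for e using that by (auto simp: W_def vs_def)
  have edge2: "\<not> e \<subseteq> {x}" if "e \<in> E" for e x
    using that by (auto elim!: graph_edgeE[OF g])
  obtain v where "v \<in> V" "v \<notin> W" using ne WV W_def by blast
  then have "ecut E W \<noteq> {}" using conn_cut[OF con, of v W] wW by blast
  then obtain a c where ac: "{a, c} \<in> E" "a \<in> W" "c \<notin> W" "a \<in> V" "c \<in> V"
    using ecutE[OF g] by (metis ex_in_conv)
  define C where "C = {v. conn (ind E (V - W)) c v}"
  define K where "K = insert a C"
  define E' where "E' = ind E K"
  have cC: "c \<in> C" by (simp add: C_def)
  have CV: "C \<subseteq> V - W" unfolding C_def using conn_in_ind ac(3,5) by fast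
  have KV: "K \<subseteq> V" using CV ac(4) by (auto simp: K_def)
  have aC: "a \<notin> C" using CV ac(2) by blast
  \<comment> \<open>If \<open>v \<noteq> a\<close>, both lie in \<open>W\<close> and a closed cut
    separates them. But the walk from \<open>a\<close> through \<open>C\<close> to \<open>v\<close>
    uses no edge inside \<open>W\<close>, hence no edge of that cut.\<close>
  have attach: "v = a" if uv: "{u, v} \<in> E" "u \<in> C" "v \<notin> C" for u v
  proof (rule ccontr)
    assume "v \<noteq> a"
    have "v \<in> V" using g uv(1) by (auto simp: graph_def doubleton_eq_iff)
    have vW: "v \<in> W"
    proof (rule ccontr)
      assume "v \<notin> W"
      then have "{u, v} \<in> ind E (V - W)" using uv \<open>v \<in> V\<close> CV by (auto simp: ind_def)
      with uv(2) have "v \<in> C" unfolding C_def by (blast intro: conn_step)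
      with uv(3) show False ..
    qed
    obtain A where A: "ecut E A \<subseteq> ind E W" "a \<in> A" "v \<notin> A"
      using closed_tree_sepE[OF ct, of a v] ac(2) vW \<open>v \<noteq> a\<close> unfolding W_def by metis
    define F where "F = E - ind E W"
    have FA: "ecut F A = {}" using A(1) unfolding F_def ecut_def by blast
    have "ind E (V - W) \<subseteq> F" using edge2 unfolding F_def ind_def by blast
    then have "conn F c u" using uv(2) conn_mono by (auto simp: C_def)
    moreover have "conn F a c"
      by (rule conn_step[OF conn_refl]) (use ac in \<open>auto simp: F_def ind_def\<close>)
    ultimately have "conn F a u" using conn_trans by metis
    moreover have "{u, v} \<in> F" using uv CV by (auto simp: F_def ind_def)
    ultimately have "conn F a v" by (rule conn_step)
    with conn_cut[OF this FA] A show False by blast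
  qed
  have gK: "graph K E'" unfolding E'_def using graph_ind[OF g] .
  have E'E: "E' \<subseteq> E" by (auto simp: E'_def ind_def)
  have fsK: "finsep K E'"
    unfolding finsep_def
  proof (intro ballI impI)
    fix x y assume "x \<in> K" "y \<in> K" "x \<noteq> y"
    then obtain A where "finite (ecut E A)" "x \<in> A" "y \<notin> A"
      using finsepE[OF fs, of x y] KV by blast
    then show "\<exists>A. finite (ecut E' A) \<and> x \<in> A \<and> y \<notin> A"
      using ecut_mono[OF E'E] finite_subset by metis
  qed
  have conK: "conn E' a v" if "v \<in> K" for v
  proof (cases "v = a")
    case False
    then have "conn (ind E C) c v"
      using that conn_component[of E "V - W" c v] by (auto simp: C_def K_def)
    moreover have "ind E C \<subseteq> E'" unfolding E'_def by (rule ind_mono) (auto simp: K_def)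
    ultimately have "conn E' c v" by (rule conn_mono)
    moreover have "conn E' a c"
      by (rule conn_step[OF conn_refl]) (use ac cC in \<open>auto simp: E'_def K_def ind_def\<close>)
    ultimately show ?thesis using conn_trans by metis
  qed simp
  \<comment> \<open>Requiring \<open>c\<close>, a vertex outside \<open>W\<close>, makes the
    extension proper.\<close>
  obtain S where S: "closed_tree E' a S" "c \<in> vs a S"
    using closed_tree_containing[OF gK fsK _ _ conK, of c] cC by (auto simp: K_def)
  have SE': "S \<subseteq> E'" using closed_tree_subset[OF S(1)] .
  have vsK: "vs a S \<subseteq> K" using vs_subset[OF gK SE', of a] by (simp add: K_def)
  \<comment> \<open>Replacing a cut of \<open>E'\<close> by the side avoiding \<open>a\<close> makes it a cut of \<open>E\<close>.\<close>
  have norm: "\<exists>B\<subseteq>C. ecut E B = ecut E' X \<and> ecut S B = ecut S X \<and>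
      (\<forall>x\<in>K. \<forall>y\<in>K. (x \<in> B \<longleftrightarrow> y \<in> B) \<longleftrightarrow> (x \<in> X \<longleftrightarrow> y \<in> X))" for X
  proof -
    define Y where "Y = (if a \<in> X then - X else X)"
    define B where "B = Y \<inter> C"
    have aY: "a \<notin> Y" by (auto simp: Y_def)
    have YX: "ecut F Y = ecut F X" for F :: "'a set set" by (simp add: Y_def ecut_compl)
    have BY: "x \<in> B \<longleftrightarrow> x \<in> Y" if "x \<in> K" for x using that aY by (auto simp: B_def K_def)
    have EY: "ecut F B = ecut F Y" if "F \<subseteq> E'" for F
    proof -
      have "e \<inter> B = e \<inter> Y \<and> e - B = e - Y" if "e \<in> F" for e
      proof -
        have "e \<subseteq> K" using that \<open>F \<subseteq> E'\<close> by (auto simp: E'_def ind_def)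
        then show ?thesis using BY by blast
      qed
      then show ?thesis unfolding ecut_def by auto
    qed
    \<comment> \<open>By \<open>attach\<close>, an edge with an end in \<open>C\<close> stays within
      \<open>K\<close>, so no edge outside \<open>E'\<close> leaves \<open>B\<close>.\<close>
    have "ecut E B \<subseteq> ecut E' B"
    proof
      fix e assume e: "e \<in> ecut E B"
      then obtain u v where uv: "e = {u, v}" "e \<in> E" "u \<in> B" "v \<notin> B" by (rule ecutE[OF g])
      have "u \<in> C" using uv(3) by (simp add: B_def)
      then have "v \<in> K" using attach[of u v] uv(1,2) by (auto simp: K_def)
      then have "e \<in> E'" using uv \<open>u \<in> C\<close> by (auto simp: E'_def ind_def K_def)
      with e show "e \<in> ecut E' B" by (simp add: ecut_def)
    qed
    then have "ecut E B = ecut E' B" using ecut_mono[OF E'E] by blast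
    then have "ecut E B = ecut E' X" "ecut S B = ecut S X" using EY SE' YX by auto
    moreover have "(x \<in> B \<longleftrightarrow> y \<in> B) \<longleftrightarrow> (x \<in> X \<longleftrightarrow> y \<in> X)" if "x \<in> K" "y \<in> K" for x y
      using BY[OF that(1)] BY[OF that(2)] by (auto simp: Y_def)
    ultimately show ?thesis by (intro exI[of _ B]) (auto simp: B_def)
  qed
  define T' where "T' = T \<union> S"
  have vsT': "vs w T' = W \<union> vs a S" using ac(2) by (auto simp: T'_def W_def vs_def)
  have indW: "ind E W \<subseteq> ind E (vs w T')" by (rule ind_mono) (simp add: vsT')
  have indS: "ind E' (vs a S) \<subseteq> ind E (vs w T')" using vsT' E'E by (auto simp: ind_def)
  have cut_un: "ecut T' A = ecut T A \<union> ecut S A" for A by (auto simp: T'_def ecut_def)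
  have "closed_tree E w T'"
    unfolding closed_tree_def
  proof (intro conjI ballI impI)
    show "T' \<subseteq> E" using TE SE' E'E by (auto simp: T'_def)
  next
    have W: "conn T' w u" if "u \<in> W" for u
      using conn_mono[OF closed_tree_conn[OF ct]] that by (auto simp: W_def T'_def)
    fix u assume "u \<in> vs w T'"
    then consider "u \<in> W" | "u \<in> vs a S" using vsT' by blast
    then show "conn T' w u"
    proof cases
      case 2
      then have "conn T' a u"
        using conn_mono[OF closed_tree_conn[OF S(1)]] by (auto simp: T'_def)
      then show ?thesis using conn_trans[OF W[OF ac(2)]] by blast
    qed (rule W)
  next
    fix e assume "e \<in> T'"
    then consider "e \<in> T" | "e \<in> S" by (auto simp: T'_def)
    then show "\<exists>A. finite (ecut E A) \<and> ecut E A \<subseteq> ind E (vs w T') \<and> ecut T' A = {e}"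
    proof cases
      case 1
      obtain A where A: "finite (ecut E A)" "ecut E A \<subseteq> ind E W" "ecut T A = {e}"
        using closed_tree_cutE[OF ct 1] unfolding W_def .
      \<comment> \<open>An edge of \<open>S\<close> lies in \<open>K\<close> and an edge of this cut
        lies in \<open>W\<close>; these sets share only \<open>a\<close>, and there are no
        loops.\<close>
      have "ecut S A = {}"
      proof (rule ccontr)
        assume "ecut S A \<noteq> {}"
        then obtain f where f: "f \<in> ecut S A" by blast
        then have "f \<in> S" by (simp add: ecut_def)
        then have "f \<subseteq> K" "f \<in> E" using SE' by (auto simp: E'_def ind_def)
        moreover have "f \<in> ecut E A" using f \<open>f \<in> E\<close> by (simp add: ecut_def)
        then have "f \<subseteq> W" using A(2) by (auto simp: ind_def)
        ultimately have "f \<subseteq> {a}" using CV by (auto simp: K_def)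
        then show False using edge2[OF \<open>f \<in> E\<close>] by blast
      qed
      then show ?thesis using A indW cut_un by (intro exI[of _ A]) auto
    next
      case 2
      obtain X where X: "finite (ecut E' X)" "ecut E' X \<subseteq> ind E' (vs a S)" "ecut S X = {e}"
        using closed_tree_cutE[OF S(1) 2] .
      obtain B where B: "B \<subseteq> C" "ecut E B = ecut E' X" "ecut S B = ecut S X"
        using norm[of X] by blast
      have "f \<inter> B = {}" if "f \<in> T" for f using TW[OF that] B(1) CV by blast
      then have "ecut T B = {}" unfolding ecut_def by blast
      then show ?thesis using B X indS cut_un by (intro exI[of _ B]) auto
    qed
  next
    let ?sep = "\<lambda>x y. \<exists>A. finite (ecut E A) \<and> ecut E A \<subseteq> ind E (vs w T') \<and> (x \<in> A) \<noteq> (y \<in> A)"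
    have sepW: "?sep x y" if "x \<in> W" "y \<in> W" "x \<noteq> y" for x y
      using closed_tree_sepE[OF ct, of x y] that indW unfolding W_def by (metis subset_trans)
    have sepS: "\<exists>A\<subseteq>C. finite (ecut E A) \<and> ecut E A \<subseteq> ind E (vs w T') \<and> (x \<in> A) \<noteq> (y \<in> A)"
      if xy: "x \<in> vs a S" "y \<in> vs a S" "x \<noteq> y" for x y
    proof -
      obtain X where X: "finite (ecut E' X)" "ecut E' X \<subseteq> ind E' (vs a S)" "x \<in> X" "y \<notin> X"
        using closed_tree_sepE[OF S(1) xy] .
      obtain B where B: "B \<subseteq> C" "ecut E B = ecut E' X"
        "\<And>x y. x \<in> K \<Longrightarrow> y \<in> K \<Longrightarrow> (x \<in> B \<longleftrightarrow> y \<in> B) \<longleftrightarrow> (x \<in> X \<longleftrightarrow> y \<in> X)"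
        using norm[of X] by blast
      have "(x \<in> B) \<noteq> (y \<in> B)" using B(3)[of x y] xy vsK X by blast
      then show ?thesis using B X indS by (intro exI[of _ B]) auto
    qed
    \<comment> \<open>A set inside \<open>C\<close> that separates \<open>a\<close> from
      \<open>y\<close> contains neither \<open>a\<close> nor \<open>x\<close>, so it separates
      \<open>x\<close> from \<open>y\<close> as well.\<close>
    have sepWS: "?sep x y" if "x \<in> W" "y \<in> vs a S" "y \<notin> W" for x y
    proof -
      have "a \<in> vs a S" "a \<noteq> y" using that ac(2) by (auto simp: vs_def)
      from sepS[OF this(1) that(2) this(2)] obtain A where A: "A \<subseteq> C" "finite (ecut E A)"
        "ecut E A \<subseteq> ind E (vs w T')" "(a \<in> A) \<noteq> (y \<in> A)" by blast
      have "(x \<in> A) \<noteq> (y \<in> A)" using A(1,4) aC CV that(1) by blast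
      with A show ?thesis by blast
    qed
    fix x y assume xy: "x \<in> vs w T'" "y \<in> vs w T'" "x \<noteq> y"
    consider "x \<in> W" "y \<in> W" | "x \<in> W" "y \<in> vs a S" "y \<notin> W" | "y \<in> W" "x \<in> vs a S" "x \<notin> W"
      | "x \<in> vs a S" "y \<in> vs a S"
      using xy vsT' by blast
    then have "?sep x y"
    proof cases
      case 1
      then show ?thesis using sepW xy(3) by blast
    next
      case 2
      then show ?thesis by (rule sepWS)
    next
      case 3
      then show ?thesis using sepWS[of y x] by metis
    next
      case 4
      then show ?thesis using sepS xy(3) by blast
    qed
    then obtain A where A: "finite (ecut E A)" "ecut E A \<subseteq> ind E (vs w T')" "(x \<in> A) \<noteq> (y \<in> A)"
      by blast
    show "\<exists>A. finite (ecut E A) \<and> ecut E A \<subseteq> ind E (vs w T') \<and> x \<in> A \<and> y \<notin> A"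
    proof (cases "x \<in> A")
      case True
      then show ?thesis using A by blast
    next
      case False
      then show ?thesis using A by (intro exI[of _ "- A"]) (simp add: ecut_compl)
    qed
  qed
  moreover have "T \<noteq> T'" using S(2) ac(3) vsT' by (auto simp: W_def)
  then have "T \<subset> T'" by (auto simp: T'_def)
  ultimately show ?thesis by blast
qed

text \<open>The cuts in the last conclusion later yield both acyclicity and finite adhesion.\<close>

lemma finite_cut_spanning_tree:
  assumes g: "graph V E" and fs: "finsep V E" and w: "w \<in> V"
    and con: "\<And>v. v \<in> V \<Longrightarrow> conn E w v"
  obtains T where "T \<subseteq> E" "\<And>v. v \<in> V \<Longrightarrow> conn T w v"
    "\<And>e. e \<in> T \<Longrightarrow> \<exists>A. finite (ecut E A) \<and> ecut T A = {e}"
proof -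
  let ?\<T> = "{T. closed_tree E w T}"
  have "closed_tree E w {}" by (auto simp: closed_tree_def vs_def)
  then have "?\<T> \<noteq> {}" by blast
  then have "\<exists>M\<in>?\<T>. \<forall>X\<in>?\<T>. M \<subseteq> X \<longrightarrow> X = M"
  proof (rule subset_Zorn_nonempty)
    fix \<C> assume "\<C> \<noteq> {}" "subset.chain ?\<T> \<C>"
    then show "\<Union>\<C> \<in> ?\<T>"
      using closed_tree_Union[of \<C> E w] unfolding subset_chain_def by blast
  qed
  then obtain T where T: "closed_tree E w T" and max: "\<And>X. closed_tree E w X \<Longrightarrow> T \<subseteq> X \<Longrightarrow> X = T"
    by blast
  have V: "vs w T = V" using closed_tree_extend[OF g fs w con T] max by blast
  show thesis
  proof (rule that)
    show "T \<subseteq> E" using closed_tree_subset[OF T] .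
    show "conn T w v" if "v \<in> V" for v using closed_tree_conn[OF T] that V by blast
    show "\<exists>A. finite (ecut E A) \<and> ecut T A = {e}" if "e \<in> T" for e
      using closed_tree_cutE[OF T that] by metis
  qed
qed

section \<open>Acyclicity, finite separability and blocks in terms of cuts\<close>

lemma reach_iff_conn:
  assumes "graph V F" "x \<in> V"
  shows "reach V F x y \<longleftrightarrow> conn F x y"
proof -
  have "(u \<in> V \<and> v \<in> V \<and> {u, v} \<in> F) = ({u, v} \<in> F)" for u v
    using assms(1) by (auto simp: graph_def doubleton_eq_iff)
  then show ?thesis using assms(2) by (simp add: reach_def conn_def)
qed

text \<open>The rest of a cycle connects the ends of its closing edge, although that edge is the
  only one of \<open>T\<close> across some \<open>A\<close>.\<close>

lemma no_cycle_if_all_bridges: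
  assumes "\<And>e. e \<in> T \<Longrightarrow> \<exists>A. ecut T A = {e}"
  shows "\<not> has_cycle V T"
proof
  assume "has_cycle V T"
  then obtain cs where cs: "length cs \<ge> 3" "distinct cs"
    "\<And>i. Suc i < length cs \<Longrightarrow> {cs ! i, cs ! Suc i} \<in> T" "{last cs, hd cs} \<in> T"
    unfolding has_cycle_def by blast
  let ?e = "{last cs, hd cs}" and ?n = "length cs - 1"
  obtain A where A: "ecut T A = {?e}" using assms[OF cs(4)] by blast
  have ends: "last cs = cs ! ?n" "hd cs = cs ! 0"
    using cs(1) last_conv_nth[of cs] hd_conv_nth[of cs] by fastforce+
  have "conn (T - {?e}) (cs ! 0) (cs ! i)" if "i < length cs" for i
    using that
  proof (induction i)
    case (Suc i)
    \<comment> \<open>A path edge equal to the closing edge would force \<open>i = 0\<close> and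
      \<open>Suc i = ?n\<close>, which length at least 3 excludes.\<close>
    have "cs ! Suc i \<noteq> cs ! 0" "\<not> (cs ! i = cs ! 0 \<and> cs ! Suc i = cs ! ?n)"
      using Suc.prems cs(1) nth_eq_iff_index_eq[OF cs(2), of "Suc i" 0]
        nth_eq_iff_index_eq[OF cs(2), of i 0] nth_eq_iff_index_eq[OF cs(2), of "Suc i" ?n]
      by linarith+
    then have "{cs ! i, cs ! Suc i} \<noteq> ?e" by (auto simp: ends doubleton_eq_iff)
    then have "{cs ! i, cs ! Suc i} \<in> T - {?e}" using cs(3) Suc.prems by blast
    then show ?case using Suc by (auto intro: conn_step)
  qed simp
  then have "conn (T - {?e}) (hd cs) (last cs)" using cs(1) ends by simp
  moreover have "ecut (T - {?e}) A = {}" by (rule ecut_singleton_remove[OF A]) auto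
  ultimately have "hd cs \<in> A \<longleftrightarrow> last cs \<in> A" by (rule conn_cut)
  then show False using ecut_singletonD[OF A] by auto
qed

text \<open>The vertices reachable from \<open>x\<close> after deleting \<open>F\<close> form a set
  whose cut lies in \<open>F\<close>; conversely, delete the cut.\<close>

lemma fin_separable_iff_cut:
  assumes g: "graph V E" and x: "x \<in> V"
  shows "fin_separable V E x y \<longleftrightarrow> (\<exists>A. finite (ecut E A) \<and> x \<in> A \<and> y \<notin> A)"
proof
  assume "fin_separable V E x y"
  then obtain F where F: "finite F" "\<not> reach V (E - F) x y" by (auto simp: fin_separable_def)
  have gF: "graph V (E - F)" using graph_subset[OF g] by blast
  let ?A = "{v. conn (E - F) x v}"
  have "ecut E ?A \<subseteq> F"
  proof
    fix e assume "e \<in> ecut E ?A"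
    then obtain u v where e: "e = {u, v}" "e \<in> E" "u \<in> ?A" "v \<notin> ?A" by (rule ecutE[OF g])
    then show "e \<in> F" using conn_step[of "E - F" x u v] by blast
  qed
  then have "finite (ecut E ?A)" using F(1) finite_subset by blast
  moreover have "y \<notin> ?A" using F(2) reach_iff_conn[OF gF x] by simp
  ultimately show "\<exists>A. finite (ecut E A) \<and> x \<in> A \<and> y \<notin> A" by (intro exI[of _ ?A]) simp
next
  assume "\<exists>A. finite (ecut E A) \<and> x \<in> A \<and> y \<notin> A"
  then obtain A where A: "finite (ecut E A)" "x \<in> A" "y \<notin> A" by blast
  have gF: "graph V (E - ecut E A)" using graph_subset[OF g] by blast
  have "ecut (E - ecut E A) A = {}" by (auto simp: ecut_def)
  then have "\<not> conn (E - ecut E A) x y" using conn_cut A by metis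
  then have "\<not> reach V (E - ecut E A) x y" using reach_iff_conn[OF gF x] by simp
  moreover have "ecut E A \<subseteq> E" by (auto simp: ecut_def)
  ultimately show "fin_separable V E x y" using A(1) by (auto simp: fin_separable_def)
qed

text \<open>The class of \<open>x\<close>, phrased by cuts: no finite cut distinguishes its members.
  The symmetric condition makes \<open>blk_eq\<close> immediate.\<close>

definition blk :: "'a set \<Rightarrow> 'a set set \<Rightarrow> 'a \<Rightarrow> 'a set" where
  "blk V E x = {y \<in> V. \<forall>A. finite (ecut E A) \<longrightarrow> (x \<in> A \<longleftrightarrow> y \<in> A)}"

lemma omega_edge_blocks_eq:
  assumes "graph V E"
  shows "omega_edge_blocks V E = blk V E ` V"
proof -
  have "{y \<in> V. \<not> fin_separable V E x y} = blk V E x" if "x \<in> V" for x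
  proof -
    have "(\<exists>A. finite (ecut E A) \<and> x \<in> A \<and> y \<notin> A) \<longleftrightarrow>
        \<not> (\<forall>A. finite (ecut E A) \<longrightarrow> (x \<in> A \<longleftrightarrow> y \<in> A))" for y
      by (metis ecut_compl Compl_iff)
    then show ?thesis using fin_separable_iff_cut[OF assms that] by (auto simp: blk_def)
  qed
  then show ?thesis unfolding omega_edge_blocks_def by blast
qed

lemma blk_self: "x \<in> V \<Longrightarrow> x \<in> blk V E x"
  by (simp add: blk_def)

lemma blk_eq: "y \<in> blk V E x \<Longrightarrow> blk V E y = blk V E x"
  by (auto simp: blk_def)

lemma blk_eq_cut:
  assumes "y \<in> V" "blk V E x = blk V E y" "finite (ecut E A)"
  shows "x \<in> A \<longleftrightarrow> y \<in> A"
proof -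
  have "y \<in> blk V E x" using blk_self assms by metis
  then show ?thesis using assms(3) by (simp add: blk_def)
qed

lemma blk_neqE:
  assumes "blk V E x \<noteq> blk V E y"
  obtains A where "finite (ecut E A)" "x \<in> A" "y \<notin> A"
proof -
  obtain A where A: "finite (ecut E A)" "(x \<in> A) \<noteq> (y \<in> A)"
    using assms by (auto simp: blk_def)
  show thesis
    using A that[of A] that[of "- A"] by (cases "x \<in> A") (auto simp: ecut_compl)
qed

section \<open>The tree on the blocks\<close>

theorem theorem2p4:
  fixes V :: "'a set" and E :: "'a set set"
  assumes "connected_graph V E"
  shows "\<exists>(VT :: 'a set set) (ET :: 'a set set set) (X :: 'a set \<Rightarrow> 'a set).
           tree_cut_decomposition V E VT ET X \<and>
           finite_adhesion E VT ET X \<and>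
           X ` VT = omega_edge_blocks V E \<and>
           (\<forall>t1 t2. {t1, t2} \<in> ET \<longrightarrow> edges_between E (X t1) (X t2) \<noteq> {})"
proof -
  have g: "graph V E" using assms by (simp add: connected_graph_def)
  obtain w where w: "w \<in> V" using assms by (auto simp: connected_graph_def)
  have con: "conn E w v" if "v \<in> V" for v
  proof -
    have "reach V E w v" using assms w that by (simp add: connected_graph_def)
    then show ?thesis using reach_iff_conn[OF g w] by simp
  qed
  let ?b = "blk V E"
  \<comment> \<open>The simple graph obtained by contracting blocks: edges inside a block disappear
    and parallel edges merge.\<close>
  define H where "H = (`) ?b ` cross E ?b"
  have eV: "e \<subseteq> V" if "e \<in> E" for e using g that by (auto simp: graph_def)
  have H_edgeE: "\<exists>u v. u \<in> V \<and> v \<in> V \<and> {u, v} \<in> E \<and> ?b u \<noteq> ?b v \<and> h = {?b u, ?b v}"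
    if "h \<in> H" for h
  proof -
    obtain e where e: "e \<in> E" "e \<in> cross E ?b" "h = ?b ` e"
      using \<open>h \<in> H\<close> by (auto simp: H_def cross_def)
    obtain u v where "u \<noteq> v" "u \<in> V" "v \<in> V" "e = {u, v}" using graph_edgeE[OF g e(1)] .
    then show ?thesis using e by (intro exI[of _ u] exI[of _ v]) (auto simp: cross_def)
  qed
  have H_edgeI: "?b ` e \<in> H" if "e \<in> E" "u \<in> e" "v \<in> e" "?b u \<noteq> ?b v" for e u v
  proof -
    have "e \<in> cross E ?b" unfolding cross_def using that by blast
    then show ?thesis unfolding H_def by (rule imageI)
  qed
  have gH: "graph (?b ` V) H"
    unfolding graph_def
  proof
    fix h assume "h \<in> H"
    from H_edgeE[OF this] obtain u v where "u \<in> V" "v \<in> V" "?b u \<noteq> ?b v" "h = {?b u, ?b v}" by blast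
    then show "\<exists>s t. s \<noteq> t \<and> s \<in> ?b ` V \<and> t \<in> ?b ` V \<and> h = {s, t}"
      by (intro exI[of _ "?b u"] exI[of _ "?b v"]) simp
  qed
  have conH: "conn H (?b w) t" if tV: "t \<in> ?b ` V" for t
  proof -
    obtain v where v: "v \<in> V" "t = ?b v" using tV by blast
    have "conn H (?b w) (?b v)" using con[OF v(1)]
    proof (induction rule: conn_induct)
      case (step u v)
      show ?case
      proof (cases "?b u = ?b v")
        case False
        then have "{?b u, ?b v} \<in> H" using H_edgeI[OF step(2), of u v] by simp
        then show ?thesis using step(3) conn_step by metis
      qed (use step in simp)
    qed simp
    then show ?thesis using v by simp
  qed
  have fsH: "finsep (?b ` V) H"
    unfolding finsep_def
  proof (intro ballI impI)
    fix s t assume "s \<in> ?b ` V" "t \<in> ?b ` V" "s \<noteq> t"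
    then obtain x y where xy: "x \<in> V" "y \<in> V" "s = ?b x" "t = ?b y" "?b x \<noteq> ?b y" by blast
    obtain A where A: "finite (ecut E A)" "x \<in> A" "y \<notin> A" using blk_neqE[OF xy(5)] .
    \<comment> \<open>A finite cut splits no block, so each block lies wholly inside or outside
      \<open>A\<close>, and \<open>?A\<close> collects those inside.\<close>
    let ?A = "{t. t \<subseteq> A}"
    have side: "?b u \<subseteq> A \<longleftrightarrow> u \<in> A" if "u \<in> V" for u
      using that A(1) blk_self[OF that, of E] by (auto simp: blk_def)
    have "ecut H ?A \<subseteq> (`) ?b ` ecut E A"
    proof
      fix h assume h: "h \<in> ecut H ?A"
      then have "h \<in> H" by (simp add: ecut_def)
      then obtain u v where uv: "u \<in> V" "v \<in> V" "{u, v} \<in> E" "h = {?b u, ?b v}"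
        using H_edgeE[OF \<open>h \<in> H\<close>] by blast
      then have "{u, v} \<in> ecut E A" using h side[of u] side[of v] by (auto simp: ecut_def)
      then show "h \<in> (`) ?b ` ecut E A" using uv(4) by (intro image_eqI[of _ _ "{u, v}"]) simp_all
    qed
    then have "finite (ecut H ?A)" by (rule finite_surj[OF A(1)])
    then show "\<exists>A. finite (ecut H A) \<and> s \<in> A \<and> t \<notin> A"
      using side xy A by (intro exI[of _ ?A]) auto
  qed
  \<comment> \<open>All edges of \<open>E\<close> over \<open>h\<close> lie in one finite cut
    separating its two blocks; this makes the preimage of a finite cut of \<open>H\<close>
    finite.\<close>
  have fibre: "finite {e \<in> E. ?b ` e = h}" if "h \<in> H" for h
  proof -
    obtain u v where uv: "u \<in> V" "v \<in> V" "?b u \<noteq> ?b v" "h = {?b u, ?b v}"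
      using H_edgeE[OF \<open>h \<in> H\<close>] by blast
    obtain A where A: "finite (ecut E A)" "u \<in> A" "v \<notin> A" using blk_neqE[OF uv(3)] .
    have "{e \<in> E. ?b ` e = h} \<subseteq> ecut E A"
    proof
      fix e assume "e \<in> {e \<in> E. ?b ` e = h}"
      then have e: "e \<in> E" "?b ` e = h" by auto
      have "?b u \<in> ?b ` e" "?b v \<in> ?b ` e" using e uv(4) by auto
      then obtain u' v' where u': "u' \<in> e" "?b u = ?b u'" and v': "v' \<in> e" "?b v = ?b v'" by blast
      have "u' \<in> A" "v' \<notin> A"
        using blk_eq_cut[OF _ u'(2) A(1)] blk_eq_cut[OF _ v'(2) A(1)] u' v' eV[OF e(1)] A by auto
      then show "e \<in> ecut E A" using e u' v' by (auto simp: ecut_def)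
    qed
    then show ?thesis using A(1) finite_subset by blast
  qed
  obtain T where T: "T \<subseteq> H" "\<And>t. t \<in> ?b ` V \<Longrightarrow> conn T (?b w) t"
    "\<And>e. e \<in> T \<Longrightarrow> \<exists>A. finite (ecut H A) \<and> ecut T A = {e}"
    using finite_cut_spanning_tree[OF gH fsH _ conH] w by (metis imageI)
  have gT: "graph (?b ` V) T" using graph_subset[OF gH T(1)] .
  have "reach (?b ` V) T s t" if "s \<in> ?b ` V" "t \<in> ?b ` V" for s t
    using conn_trans[OF conn_sym[OF T(2)[OF that(1)]] T(2)[OF that(2)]]
    by (simp add: reach_iff_conn[OF gT that(1)])
  then have "connected_graph (?b ` V) T" using gT w by (auto simp: connected_graph_def)
  moreover have "\<not> has_cycle (?b ` V) T" using T(3) by (intro no_cycle_if_all_bridges) blast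
  ultimately have tree: "is_tree (?b ` V) T" by (simp add: is_tree_def)
  have blockE: "?b u = t" if "t \<in> ?b ` V" "u \<in> t" for u t
    using that(1) by (rule imageE) (use that(2) in \<open>simp add: blk_eq\<close>)
  \<comment> \<open>The tree nodes are the blocks themselves, so the parts are given by the
    identity.\<close>
  have decomp: "tree_cut_decomposition V E (?b ` V) T (\<lambda>t. t)"
    unfolding tree_cut_decomposition_def
  proof (intro conjI ballI impI)
    show "is_tree (?b ` V) T" by fact
    show "t \<noteq> {}" if "t \<in> ?b ` V" for t
      using that by (rule imageE) (use blk_self[of _ V E] in auto)
    show "t \<inter> s = {}" if "t \<in> ?b ` V" "s \<in> ?b ` V" "t \<noteq> s" for t s
    proof (rule ccontr)
      assume "t \<inter> s \<noteq> {}"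
      then obtain u where u: "u \<in> t" "u \<in> s" by blast
      show False using blockE[OF that(1) u(1)] blockE[OF that(2) u(2)] that(3) by simp
    qed
    show "(\<Union>t\<in>?b ` V. t) = V"
    proof
      show "(\<Union>t\<in>?b ` V. t) \<subseteq> V" by (auto simp: blk_def)
      show "V \<subseteq> (\<Union>t\<in>?b ` V. t)" using blk_self[of _ V E] by auto
    qed
  qed
  have "finite (adhesion E (?b ` V) T (\<lambda>t. t) t1 t2)" if t: "{t1, t2} \<in> T" for t1 t2
  proof -
    let ?T = "T - {{t1, t2}}"
    obtain A where A: "finite (ecut H A)" "ecut T A = {{t1, t2}}" using T(3)[OF t] by blast
    have gT': "graph (?b ` V) ?T" using graph_subset[OF gT] by blast
    \<comment> \<open>Without \<open>{t1, t2}\<close> no tree edge crosses \<open>A\<close>, so each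
      of the two tree components lies on one side.\<close>
    have TA: "ecut ?T A = {}" by (rule ecut_singleton_remove[OF A(2)]) auto
    have reach_side: "t \<in> A \<longleftrightarrow> s \<in> A" "s \<in> ?b ` V" if "reach (?b ` V) ?T t s" for t s
    proof -
      have tV: "t \<in> ?b ` V" using that by (simp add: reach_def)
      then have c: "conn ?T t s" using that reach_iff_conn[OF gT'] by blast
      show "t \<in> A \<longleftrightarrow> s \<in> A" using conn_cut[OF c TA] .
      show "s \<in> ?b ` V" using conn_in_vs[OF c] vs_subset[OF gT' subset_refl tV] by (rule subsetD[rotated])
    qed
    have t12: "(t1 \<in> A) \<noteq> (t2 \<in> A)" using ecut_singletonD[OF A(2)] by auto
    \<comment> \<open>An edge of the adhesion set joins blocks on different sides of
      \<open>A\<close>, so its image is in the finite cut of \<open>H\<close>.\<close>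
    have "adhesion E (?b ` V) T (\<lambda>t. t) t1 t2 \<subseteq> (\<Union>h\<in>ecut H A. {e \<in> E. ?b ` e = h})"
    proof
      fix e assume "e \<in> adhesion E (?b ` V) T (\<lambda>t. t) t1 t2"
      then obtain u v s1 s2 where e: "e \<in> E" "e = {u, v}" "u \<in> s1" "v \<in> s2"
        "reach (?b ` V) ?T t1 s1" "reach (?b ` V) ?T t2 s2"
        unfolding adhesion_def edges_between_def by blast
      have s: "?b u = s1" "?b v = s2"
        by (rule blockE[OF reach_side(2)[OF e(5)] e(3)], rule blockE[OF reach_side(2)[OF e(6)] e(4)])
      have sA: "(s1 \<in> A) \<noteq> (s2 \<in> A)"
        using reach_side(1)[OF e(5)] reach_side(1)[OF e(6)] t12 by blast
      then have "?b u \<noteq> ?b v" using s by metis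
      then have "?b ` e \<in> H" using H_edgeI[OF e(1), of u v] e(2) by simp
      then have "?b ` e \<in> ecut H A" using sA s e(2) by (auto simp: ecut_def)
      then show "e \<in> (\<Union>h\<in>ecut H A. {e \<in> E. ?b ` e = h})" using e(1) by blast
    qed
    moreover have "finite (\<Union>h\<in>ecut H A. {e \<in> E. ?b ` e = h})"
      using A(1) fibre by (intro finite_UN_I) (auto simp: ecut_def)
    ultimately show ?thesis by (rule finite_subset)
  qed
  then have adh: "finite_adhesion E (?b ` V) T (\<lambda>t. t)" by (simp add: finite_adhesion_def)
  have "edges_between E t1 t2 \<noteq> {}" if "{t1, t2} \<in> T" for t1 t2
  proof -
    obtain u v where uv: "u \<in> V" "v \<in> V" "{u, v} \<in> E" "{t1, t2} = {?b u, ?b v}"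
      using H_edgeE[OF subsetD[OF T(1) \<open>{t1, t2} \<in> T\<close>]] by blast
    then consider "t1 = ?b u" "t2 = ?b v" | "t1 = ?b v" "t2 = ?b u"
      by (auto simp: doubleton_eq_iff)
    then have "{u, v} \<in> edges_between E t1 t2"
      using uv(1-3) blk_self[of _ V E] unfolding edges_between_def
      by cases (auto simp: insert_commute)
    then show ?thesis by blast
  qed
  then show ?thesis
    using decomp adh omega_edge_blocks_eq[OF g]
    by (intro exI[of _ "?b ` V"] exI[of _ T] exI[of _ "\<lambda>t. t"]) auto
qed

end
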